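(* Let $q\in(0,1)$, $f\in C[0,1]$, and $\rho(z)=\sum_{j=0}^{\infty} \frac{f(q^j) q^j}{(q;q)_j}z^j$. Let $R>1$ be such that $\rho$ is analytic in the closed disc $\Delta_R=\{z\in\mathbb{C}:|z|\leqslant R\}$. Then, for every $\lambda<(\ln R)/\ln(1/q)$, $$M(r;D_{\infty,q}f)=o \left( \frac {(-r;q)_{\infty}} {r^{\lambda}} \right), \quad r \to \infty.$$
   Context: For $a\in\mathbb{C}$ and $0<q<1$, the $q$-Pochhammer symbols are $(a;q)_0=1$, $(a;q)_n=\prod_{j=0}^{n-1}(1-aq^j)$, $(a;q)_\infty=\prod_{j=0}^{\infty}(1-aq^j)$. The limit $q$-Durrmeyer operator is defined for $f\in C[0,1]$ by $(D_{\infty,q}f)(x)=\sum_{k=0}^{\infty} A_{\infty k}(f)\, p_{\infty k}(q;x)$ for $x\in[0,1)$ and $(D_{\infty,q}f)(1)=f(1)$, where $p_{\infty k}(q;x)=\frac{(x;q)_\infty\, x^k}{(q;q)_k}$ and $A_{\infty k}(f)=\frac{q^{-k}}{1-q}\int_0^1 f(t)\,p_{\infty k}(q;qt)\,d_qt$. Here the $q$-integral is $\int_0^a h(t)\,d_qt=(1-q)a\sum_{j=0}^\infty q^j h(aq^j)$. Equivalently, $A_{\infty k}(f)=\frac{(q;q)_\infty}{(q;q)_k}\sum_{j=0}^\infty \frac{f(q^j)q^{(k+1)j}}{(q;q)_j}$. The function $D_{\infty,q}f$ extends (uniquely) from $[0,1]$ to an entire function, still denoted $D_{\infty,q}f$.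 For a function $h$ analytic in $\Delta_r=\{z\in\mathbb{C}:|z|\leqslant r\}$, $M(r;h)=\max_{z\in\Delta_r}|h(z)|$. The series defining $\rho$ converges at least for $|z|<1/q$; "$\rho$ is analytic in $\Delta_R$" means analytic in an open neighbourhood of the closed disc (equivalently, the power series has radius of convergence greater than $R$). *)

theory Defs
  imports "HOL-Complex_Analysis.Complex_Analysis" "HOL-Library.Landau_Symbols"
begin

(* The base q is always real; the argument a may be real or complex. *)

definition qpoch :: "'a::real_normed_field \<Rightarrow> real \<Rightarrow> nat \<Rightarrow> 'a" where
  "qpoch a q n = (\<Prod>j<n. (1 - a * of_real q ^ j))"

definition qpoch_inf :: "'a::real_normed_field \<Rightarrow> real \<Rightarrow> 'a" where
  "qpoch_inf a q = (\<Prod>j. (1 - a * of_real q ^ j))"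

definition q_integral :: "real \<Rightarrow> real \<Rightarrow> (real \<Rightarrow> complex) \<Rightarrow> complex" where
  "q_integral q a h = of_real ((1 - q) * a) * (\<Sum>j. of_real (q ^ j) * h (a * q ^ j))"

definition p_inf :: "real \<Rightarrow> nat \<Rightarrow> real \<Rightarrow> real" where
  "p_inf q k x = qpoch_inf x q * x ^ k / qpoch q q k"

definition A_inf :: "real \<Rightarrow> nat \<Rightarrow> (real \<Rightarrow> complex) \<Rightarrow> complex" where
  "A_inf q k f =
     of_real (inverse (q ^ k) / (1 - q)) *
     q_integral q 1 (\<lambda>t. f t * of_real (p_inf q k (q * t)))"

(* Only the values for x in [0,1] are meaningful. *)
definition durrmeyer :: "real \<Rightarrow> (real \<Rightarrow> complex) \<Rightarrow> real \<Rightarrow> complex" where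
  "durrmeyer q f x =
     (if x = 1 then f 1 else (\<Sum>k. A_inf q k f * of_real (p_inf q k x)))"

(* The unique entire function extending the limit q-Durrmeyer image of f from [0,1].
   The series above cannot be used for this: it diverges in general for |z| > 1. *)
definition durrmeyer_entire :: "real \<Rightarrow> (real \<Rightarrow> complex) \<Rightarrow> complex \<Rightarrow> complex" where
  "durrmeyer_entire q f =
     (THE g. g holomorphic_on UNIV \<and> (\<forall>x\<in>{0..1}. g (of_real x) = durrmeyer q f x))"

(* suminf takes one fixed value at all points of divergence.  By the identity theorem,
   "rho q f analytic_on cball 0 R" therefore holds exactly when the power series has
   radius of convergence greater than R. *)
definition rho :: "real \<Rightarrow> (real \<Rightarrow> complex) \<Rightarrow> complex \<Rightarrow> complex" where
  "rho q f z = (\<Sum>j. f (q ^ j) * of_real (q ^ j) / of_real (qpoch q q j) * z ^ j)"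

definition max_modulus :: "real \<Rightarrow> (complex \<Rightarrow> complex) \<Rightarrow> real" where
  "max_modulus r h = (SUP z\<in>cball 0 r. norm (h z))"

(* For continuous h the supremum is a maximum. *)
lemma max_modulus_attained:
  assumes "continuous_on (cball 0 r) h" and "r \<ge> 0"
  shows "\<exists>z\<in>cball 0 r. max_modulus r h = norm (h z) \<and> (\<forall>w\<in>cball 0 r. norm (h w) \<le> norm (h z))"
proof -
  have "\<exists>z\<in>cball 0 r. \<forall>w\<in>cball 0 r. norm (h w) \<le> norm (h z)"
    using assms by (intro continuous_attains_sup) (auto intro: continuous_on_norm)
  then obtain z where z: "z \<in> cball 0 r" "\<forall>w\<in>cball 0 r. norm (h w) \<le> norm (h z)"
    by blast
  have "max_modulus r h = norm (h z)"
    unfolding max_modulus_def using z by (intro cSup_eq_maximum) auto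
  with z show ?thesis by blast
qed

end

theory Submission
  imports Defs
begin

text \<open>Write \<open>G(u) = \<rho>(u) (uq;q)\<^sub>\<infinity>\<^sup>2 = \<Sum>m. d\<^sub>m u\<^sup>m\<close>, which is analytic in the disc of radius \<open>R\<close>.
  Since \<open>(q;q)\<^sub>\<infinity> = (q;q)\<^sub>k (q\<^bsup>k+1\<^esup>;q)\<^sub>\<infinity>\<close>, the Durrmeyer series is
  \<open>(x;q)\<^sub>\<infinity> / (q;q)\<^sub>\<infinity> \<Sum>k. G(q\<^sup>k) x\<^sup>k\<close>, and expanding \<open>G\<close> and summing over \<open>k\<close> first turns it into
  \<open>(x;q)\<^sub>\<infinity> / (q;q)\<^sub>\<infinity> \<Sum>m. d\<^sub>m / (1 - x q\<^sup>m)\<close>. Each pole is cancelled by a factor of \<open>(x;q)\<^sub>\<infinity>\<close>, so this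
  is the entire extension.

  Since \<open>G\<close> vanishes at the points \<open>q\<^bsup>-i\<^esup>\<close> with \<open>i \<ge> 1\<close> inside the disc,
  the first terms of the expansion of \<open>1 / (1 - z q\<^sup>m)\<close> in powers of \<open>1 / z\<close> contribute nothing. What remains is
  bounded by a multiple of \<open>(-r;q)\<^sub>\<infinity> r powr (-\<mu>)\<close> on \<open>|z| = r\<close> whenever \<open>\<mu> \<ge> 0\<close> and
  \<open>q powr (-\<mu>) < R\<close>. The maximum modulus principle gives the bound on the disc.\<close>

section \<open>Infinite \<open>q\<close>-Pochhammer symbols\<close>

lemma qpoch_0 [simp]: "qpoch a q 0 = 1"
  by (simp add: qpoch_def)

lemma qpoch_Suc: "qpoch a q (Suc n) = qpoch a q n * (1 - a * of_real q ^ n)"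
  by (simp add: qpoch_def)

lemma qpoch_add: "qpoch a q (m + n) = qpoch a q m * qpoch (a * of_real q ^ m) q n"
  by (induction n) (simp_all add: qpoch_Suc power_add mult_ac)

lemma qpoch_of_real: "qpoch (of_real x) q n = of_real (qpoch x q n)"
  by (simp add: qpoch_def)

lemma convergent_prod_qpoch:
  fixes a :: "'a::{real_normed_field, banach}"
  assumes "\<bar>q\<bar> < 1"
  shows "convergent_prod (\<lambda>j. 1 - a * of_real q ^ j)"
proof -
  have "summable (\<lambda>j. norm ((1 - a * of_real q ^ j) - 1))"
    using assms by (auto simp: norm_mult norm_power intro!: summable_mult summable_geometric)
  then show ?thesis
    by (intro abs_convergent_prod_imp_convergent_prod summable_imp_abs_convergent_prod)
qed

lemma qpoch_tendsto:
  fixes a :: "'a::{real_normed_field, banach}"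
  assumes "\<bar>q\<bar> < 1"
  shows "(\<lambda>n. qpoch a q n) \<longlonglongrightarrow> qpoch_inf a q"
proof -
  \<comment> \<open>\<open>convergent_prod_LIMSEQ\<close> speaks of products over indices up to and
    including \<open>n\<close>, hence the shift by one.\<close>
  have "(\<lambda>n. qpoch a q (Suc n)) \<longlonglongrightarrow> qpoch_inf a q"
    using convergent_prod_LIMSEQ[OF convergent_prod_qpoch[OF assms, of a]]
    unfolding qpoch_def qpoch_inf_def lessThan_Suc_atMost .
  then show ?thesis by (rule LIMSEQ_imp_Suc)
qed

lemma qpoch_inf_split:
  fixes a :: "'a::{real_normed_field, banach}"
  assumes "\<bar>q\<bar> < 1"
  shows "qpoch_inf a q = qpoch a q m * qpoch_inf (a * of_real q ^ m) q"
proof (rule LIMSEQ_unique)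
  show "(\<lambda>n. qpoch a q (m + n)) \<longlonglongrightarrow> qpoch_inf a q"
    using LIMSEQ_ignore_initial_segment[OF qpoch_tendsto[OF assms], of a m] by (simp add: add.commute)
  show "(\<lambda>n. qpoch a q (m + n)) \<longlonglongrightarrow> qpoch a q m * qpoch_inf (a * of_real q ^ m) q"
    unfolding qpoch_add by (intro tendsto_intros qpoch_tendsto assms)
qed

lemma qpoch_inf_of_real:
  assumes "\<bar>q\<bar> < 1"
  shows "qpoch_inf (of_real x :: 'a::{real_normed_field, banach}) q = of_real (qpoch_inf x q)"
proof (rule LIMSEQ_unique)
  show "(\<lambda>n. qpoch (of_real x :: 'a) q n) \<longlonglongrightarrow> of_real (qpoch_inf x q)"
    unfolding qpoch_of_real by (intro tendsto_of_real qpoch_tendsto assms)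
qed (rule qpoch_tendsto[OF assms])

section \<open>Majorants, signs and zeros of the products\<close>

lemma norm_qpoch_le:
  assumes "0 \<le> q"
  shows "norm (qpoch a q n) \<le> qpoch (- norm a) q n"
proof -
  have "norm (1 - a * of_real q ^ j) \<le> 1 - (- norm a) * of_real q ^ j" for j
    using norm_triangle_ineq4[of 1 "a * of_real q ^ j"] assms by (simp add: norm_mult norm_power)
  then show ?thesis
    unfolding qpoch_def prod_norm[symmetric] by (intro prod_mono) auto
qed

lemma norm_qpoch_inf_le:
  fixes a :: "'a::{real_normed_field, banach}"
  assumes "0 \<le> q" "q < 1"
  shows "norm (qpoch_inf a q) \<le> qpoch_inf (- norm a) q"
  by (rule LIMSEQ_le[OF tendsto_norm[OF qpoch_tendsto] qpoch_tendsto])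
     (use assms in \<open>auto intro: norm_qpoch_le\<close>)

lemma qpoch_mono:
  fixes x y :: real
  assumes "0 \<le> q" "x \<le> y" "y \<le> 0"
  shows "qpoch y q n \<le> qpoch x q n"
proof -
  have "y * q ^ j \<le> 0" for j
    using assms by (simp add: mult_nonpos_nonneg)
  then have "0 \<le> 1 - y * q ^ j" for j
    by (smt (verit))
  then show ?thesis
    unfolding qpoch_def using assms by (intro prod_mono) (auto intro!: mult_right_mono)
qed

lemma qpoch_inf_mono:
  fixes x y :: real
  assumes "0 \<le> q" "q < 1" "x \<le> y" "y \<le> 0"
  shows "qpoch_inf y q \<le> qpoch_inf x q"
  by (rule LIMSEQ_le[OF qpoch_tendsto qpoch_tendsto]) (use assms in \<open>auto intro: qpoch_mono\<close>)

lemma qpoch_inf_pos: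
  fixes x :: real
  assumes "0 \<le> q" "q < 1" "x < 1"
  shows "0 < qpoch_inf x q"
  unfolding qpoch_inf_def
proof (rule less_0_prodinf)
  show "convergent_prod (\<lambda>j. 1 - x * of_real q ^ j)"
    using assms by (intro convergent_prod_qpoch) auto
  fix j
  have "x * q ^ j < 1"
  proof (cases "x \<le> 0")
    case True
    with assms have "x * q ^ j \<le> 0" by (simp add: mult_nonpos_nonneg)
    then show ?thesis by simp
  next
    case False
    then have "x * q ^ j \<le> x * 1"
      using assms by (intro mult_left_mono power_le_one) auto
    with assms show ?thesis by simp
  qed
  then show "0 < 1 - x * of_real q ^ j" by simp
qed

lemma qpoch_inf_le_1:
  fixes x :: real
  assumes "0 \<le> q" "q < 1" "0 \<le> x" "x \<le> 1"
  shows "qpoch_inf x q \<le> 1"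
proof (rule LIMSEQ_le_const2[OF qpoch_tendsto])
  have "x * q ^ j \<le> 1" for j
    using assms by (simp add: mult_le_one power_le_one)
  then show "\<exists>N. \<forall>n\<ge>N. qpoch x q n \<le> 1"
    unfolding qpoch_def using assms by (intro exI allI impI prod_le_1) auto
qed (use assms in auto)

text \<open>Splitting off \<open>Suc m\<close> factors puts the vanishing factor, of index
  \<open>m\<close>, into the finite part.\<close>

lemma qpoch_inf_eq_0:
  fixes a :: "'a::{real_normed_field, banach}"
  assumes "\<bar>q\<bar> < 1" "a * of_real q ^ m = 1"
  shows "qpoch_inf a q = 0"
  using qpoch_inf_split[OF assms(1), of a "Suc m"] assms(2) by (simp add: qpoch_Suc)

text \<open>The partial products are polynomials. On a disc of radius 1 the deviations of the
  factors from 1 are dominated by a geometric series, so convergence is locally uniform.\<close>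

lemma holomorphic_qpoch_inf:
  assumes "\<bar>q\<bar> < 1"
  shows "(\<lambda>z. qpoch_inf z q) holomorphic_on UNIV"
proof (rule holomorphic_uniform_sequence)
  show "(\<lambda>z. qpoch z q n) holomorphic_on UNIV" for n
    unfolding qpoch_def by (intro holomorphic_intros)
  fix x :: complex
  have "uniformly_convergent_on (cball x 1) (\<lambda>N z. \<Prod>j<N. 1 - z * of_real q ^ j)"
  proof (rule uniformly_convergent_on_prod')
    show "uniformly_convergent_on (cball x 1) (\<lambda>N z. \<Sum>j<N. norm (1 - z * of_real q ^ j - 1))"
    proof (rule Weierstrass_m_test')
      show "summable (\<lambda>j. (norm x + 1) * \<bar>q\<bar> ^ j)"
        using assms by (intro summable_mult summable_geometric) auto
      fix j :: nat and z assume "z \<in> cball x 1"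
      then have "norm z \<le> norm x + 1"
        using norm_triangle_ineq2[of z x] by (simp add: dist_norm norm_minus_commute)
      then show "norm (norm (1 - z * of_real q ^ j - 1)) \<le> (norm x + 1) * \<bar>q\<bar> ^ j"
        by (simp add: norm_mult norm_power mult_right_mono)
    qed
  qed (auto intro!: continuous_intros)
  then obtain l where l: "uniform_limit (cball x 1) (\<lambda>N z. qpoch z q N) l sequentially"
    unfolding uniformly_convergent_on_def qpoch_def by blast
  have "l z = qpoch_inf z q" if "z \<in> cball x 1" for z
    using LIMSEQ_unique[OF tendsto_uniform_limitI[OF l that] qpoch_tendsto[OF assms]] .
  then have "uniform_limit (cball x 1) (\<lambda>N z. qpoch z q N) l sequentially
      \<longleftrightarrow> uniform_limit (cball x 1) (\<lambda>N z. qpoch z q N) (\<lambda>z. qpoch_inf z q) sequentially"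
    by (intro uniform_limit_cong') auto
  with l have "uniform_limit (cball x 1) (\<lambda>N z. qpoch z q N) (\<lambda>z. qpoch_inf z q) sequentially"
    by simp
  then show "\<exists>d>0. cball x d \<subseteq> UNIV \<and> uniform_limit (cball x d) (\<lambda>N z. qpoch z q N) (\<lambda>z. qpoch_inf z q) sequentially"
    by (intro exI[of _ 1]) auto
qed auto

lemma holomorphic_on_qpoch_inf [holomorphic_intros]:
  assumes "\<bar>q\<bar> < 1" "g holomorphic_on A"
  shows "(\<lambda>z. qpoch_inf (g z) q) holomorphic_on A"
  using holomorphic_on_compose[OF assms(2) holomorphic_on_subset[OF holomorphic_qpoch_inf[OF assms(1)]]]
  by (simp add: o_def)


section \<open>The product with one factor removed\<close>

text \<open>This is \<open>qpoch_inf z q / (1 - z * q ^ m)\<close> with the removable singularity at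
  \<open>z = q powr (- m)\<close> filled in. The product form avoids a division by zero
  there.\<close>

definition qpoch_skip :: "real \<Rightarrow> nat \<Rightarrow> complex \<Rightarrow> complex" where
  "qpoch_skip q m z = qpoch z q m * qpoch_inf (z * of_real q ^ Suc m) q"

lemma qpoch_skip_mult:
  assumes "\<bar>q\<bar> < 1"
  shows "qpoch_skip q m z * (1 - z * of_real q ^ m) = qpoch_inf z q"
  unfolding qpoch_skip_def using qpoch_inf_split[OF assms, of z "Suc m"] by (simp add: qpoch_Suc)

lemma holomorphic_qpoch_skip:
  assumes "\<bar>q\<bar> < 1"
  shows "qpoch_skip q m holomorphic_on A"
  unfolding qpoch_skip_def[abs_def] qpoch_def by (intro holomorphic_intros assms)

text \<open>The factor \<open>1 + norm z * q ^ m\<close> is exactly the one missing from the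
  majorant at \<open>- norm z\<close>. Keeping it on the left saves room for a fractional power of
  \<open>1 / norm z\<close> later.\<close>

lemma norm_qpoch_skip_le:
  assumes "0 \<le> q" "q < 1"
  shows "norm (qpoch_skip q m z) * (1 + norm z * q ^ m) \<le> qpoch_inf (- norm z) q"
proof -
  have "norm (qpoch_inf (z * of_real q ^ Suc m) q) \<le> qpoch_inf (- (norm z * q ^ Suc m)) q"
    using norm_qpoch_inf_le[OF assms, of "z * of_real q ^ Suc m"] assms
    by (simp add: norm_mult norm_power)
  then have "norm (qpoch_skip q m z) \<le> qpoch (- norm z) q m * qpoch_inf (- (norm z * q ^ Suc m)) q"
    unfolding qpoch_skip_def norm_mult using norm_qpoch_le[OF assms(1), of z m]
    by (intro mult_mono) (auto intro: order_trans[OF norm_ge_zero])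
  then have "norm (qpoch_skip q m z) * (1 + norm z * q ^ m)
      \<le> qpoch (- norm z) q m * qpoch_inf (- (norm z * q ^ Suc m)) q * (1 + norm z * q ^ m)"
    using assms by (intro mult_right_mono) auto
  also have "\<dots> = qpoch_inf (- norm z) q"
    using qpoch_inf_split[of q "- norm z" "Suc m"] assms by (simp add: qpoch_Suc)
  finally show ?thesis .
qed

lemma norm_qpoch_skip_le':
  assumes "0 \<le> q" "q < 1" "norm z \<le> r"
  shows "norm (qpoch_skip q m z) \<le> qpoch_inf (- r) q"
proof -
  have "norm (qpoch_skip q m z) * 1 \<le> norm (qpoch_skip q m z) * (1 + norm z * q ^ m)"
    using assms by (intro mult_left_mono) auto
  also have "\<dots> \<le> qpoch_inf (- norm z) q"
    using assms by (intro norm_qpoch_skip_le) auto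
  also have "\<dots> \<le> qpoch_inf (- r) q"
    using assms by (intro qpoch_inf_mono) auto
  finally show ?thesis by simp
qed

section \<open>Series of products with one factor removed, and their decay\<close>

lemma summable_qpoch_skip:
  assumes "0 \<le> q" "q < 1" "summable (\<lambda>m. norm (d m))"
  shows "summable (\<lambda>m. d m * qpoch_skip q m z)"
proof (rule summable_comparison_test'[of "\<lambda>m. norm (d m) * qpoch_inf (- norm z) q" 0])
  show "norm (d m * qpoch_skip q m z) \<le> norm (d m) * qpoch_inf (- norm z) q" for m
    unfolding norm_mult using norm_qpoch_skip_le'[OF assms(1,2) order_refl] by (intro mult_left_mono) auto
qed (intro summable_mult2 assms)

lemma holomorphic_suminf_qpoch_skip:
  assumes "0 \<le> q" "q < 1" "summable (\<lambda>m. norm (d m))"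
  shows "(\<lambda>z. \<Sum>m. d m * qpoch_skip q m z) holomorphic_on UNIV"
proof (rule holomorphic_uniform_sequence)
  show "(\<lambda>z. \<Sum>m<n. d m * qpoch_skip q m z) holomorphic_on UNIV" for n
    using assms by (intro holomorphic_intros holomorphic_qpoch_skip) auto
  fix x :: complex
  have "uniform_limit (cball x 1) (\<lambda>n z. \<Sum>m<n. d m * qpoch_skip q m z)
          (\<lambda>z. \<Sum>m. d m * qpoch_skip q m z) sequentially"
  proof (rule Weierstrass_m_test)
    show "summable (\<lambda>m. norm (d m) * qpoch_inf (- (norm x + 1)) q)"
      by (intro summable_mult2 assms)
    fix m z assume "z \<in> cball x 1"
    then have "norm z \<le> norm x + 1"
      using norm_triangle_ineq2[of z x] by (simp add: dist_norm norm_minus_commute)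
    then show "norm (d m * qpoch_skip q m z) \<le> norm (d m) * qpoch_inf (- (norm x + 1)) q"
      unfolding norm_mult by (intro mult_left_mono norm_qpoch_skip_le' assms) auto
  qed
  then show "\<exists>e>0. cball x e \<subseteq> UNIV \<and> uniform_limit (cball x e)
      (\<lambda>n z. \<Sum>m<n. d m * qpoch_skip q m z) (\<lambda>z. \<Sum>m. d m * qpoch_skip q m z) sequentially"
    by (intro exI[of _ 1]) auto
qed auto

text \<open>Dividing \<open>qpoch_skip q m z * (1 - z * q ^ m) = qpoch_inf z q\<close> by \<open>z * q ^ m\<close> trades a factor
  \<open>1 / z\<close> for a factor \<open>q powr (- m)\<close> in the coefficients, as long as the
  moments \<open>\<Sum>m. d m * (inverse q ^ i) ^ m\<close> vanish.\<close>

lemma suminf_qpoch_skip_shift: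
  fixes d :: "nat \<Rightarrow> complex"
  assumes q: "0 < q" "q < 1" and z: "z \<noteq> 0"
    and sm: "\<And>i. i \<le> n \<Longrightarrow> summable (\<lambda>m. norm (d m * of_real ((inverse q ^ i) ^ m)))"
    and moments: "\<And>i. 1 \<le> i \<Longrightarrow> i \<le> n \<Longrightarrow> (\<Sum>m. d m * of_real ((inverse q ^ i) ^ m)) = 0"
  shows "(\<Sum>m. d m * qpoch_skip q m z)
       = inverse z ^ n * (\<Sum>m. d m * of_real ((inverse q ^ n) ^ m) * qpoch_skip q m z)"
  using sm moments
proof (induction n)
  case 0
  then show ?case by simp
next
  case (Suc n)
  let ?a = "\<lambda>i m. d m * of_real ((inverse q ^ i) ^ m)"
  have q': "0 \<le> q" "\<bar>q\<bar> < 1" using q by auto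
  \<comment> \<open>With \<open>w = q ^ m\<close> and \<open>S\<close> the skipped product,
    \<open>w * S = (S - S * (1 - z * w)) / z\<close>. Here \<open>S * (1 - z * w)\<close> is the
    full product, independent of \<open>m\<close>, so the subtracted terms sum to a multiple of a
    moment.\<close>
  have eq: "?a n m * qpoch_skip q m z
      = inverse z * (?a (Suc n) m * qpoch_skip q m z) - inverse z * qpoch_inf z q * ?a (Suc n) m" for m
  proof -
    have "?a n m = ?a (Suc n) m * of_real q ^ m"
      using q by (simp add: power_mult_distrib power_inverse)
    moreover have "X * w * S = inverse z * (X * S) - inverse z * (S * (1 - z * w)) * X" for X w S
      using z by (simp add: algebra_simps)
    ultimately show ?thesis
      unfolding qpoch_skip_mult[OF q'(2), of m z, symmetric] by metis
  qed
  have s: "summable (\<lambda>m. ?a (Suc n) m * qpoch_skip q m z)"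
    using Suc.prems(1)[of "Suc n"] q by (intro summable_qpoch_skip) auto
  have s': "summable (?a (Suc n))"
    using Suc.prems(1)[of "Suc n"] by (intro summable_norm_cancel[of "?a (Suc n)"]) auto
  have "(\<Sum>m. ?a n m * qpoch_skip q m z) = inverse z * (\<Sum>m. ?a (Suc n) m * qpoch_skip q m z)
      - inverse z * qpoch_inf z q * (\<Sum>m. ?a (Suc n) m)"
    unfolding eq suminf_mult[OF s, symmetric] suminf_mult[OF s', symmetric]
    by (intro suminf_diff[symmetric] summable_mult s s')
  also have "(\<Sum>m. ?a (Suc n) m) = 0"
    using Suc.prems(2)[of "Suc n"] by simp
  finally have "(\<Sum>m. ?a n m * qpoch_skip q m z) = inverse z * (\<Sum>m. ?a (Suc n) m * qpoch_skip q m z)"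
    by simp
  moreover have "(\<Sum>m. d m * qpoch_skip q m z) = inverse z ^ n * (\<Sum>m. ?a n m * qpoch_skip q m z)"
    using Suc.prems by (intro Suc.IH) auto
  ultimately show ?case by (simp add: mult_ac)
qed

text \<open>The integer part of \<mu> comes from the shift, which consumes the vanishing moments.
  The fractional part comes from the spare factor in \<open>norm_qpoch_skip_le\<close>.\<close>

lemma norm_suminf_qpoch_skip_le:
  fixes d :: "nat \<Rightarrow> complex"
  assumes q: "0 < q" "q < 1" and "0 \<le> \<mu>" and z: "z \<noteq> 0"
    and sm: "summable (\<lambda>m. norm (d m) * (q powr (- \<mu>)) ^ m)"
    and moments: "\<And>i. 1 \<le> i \<Longrightarrow> real i \<le> \<mu> \<Longrightarrow> (\<Sum>m. d m * of_real ((inverse q ^ i) ^ m)) = 0"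
  shows "norm (\<Sum>m. d m * qpoch_skip q m z)
       \<le> (\<Sum>m. norm (d m) * (q powr (- \<mu>)) ^ m) * (qpoch_inf (- norm z) q * norm z powr (- \<mu>))"
proof -
  define N where "N = nat \<lfloor>\<mu>\<rfloor>"
  define s where "s = \<mu> - real N"
  have s: "0 \<le> s" "s \<le> 1" "real N \<le> \<mu>"
    using \<open>0 \<le> \<mu>\<close> by (auto simp: N_def s_def) linarith+
  have qi: "inverse q ^ i = q powr (- real i)" for i
    using q by (simp add: powr_minus powr_realpow power_inverse)
  have norm_a: "norm (d m * of_real ((inverse q ^ i) ^ m)) = norm (d m) * (q powr (- real i)) ^ m" for i m
    using q by (simp add: norm_mult norm_power norm_inverse qi[symmetric])
  have sma: "summable (\<lambda>m. norm (d m * of_real ((inverse q ^ i) ^ m)))" if "i \<le> N" for i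
  proof (rule summable_comparison_test'[OF sm, of 0])
    have "q powr (- real i) \<le> q powr (- \<mu>)"
      using q s that by (intro powr_mono') auto
    then show "norm (norm (d m * of_real ((inverse q ^ i) ^ m))) \<le> norm (d m) * (q powr (- \<mu>)) ^ m" for m
      unfolding norm_a by (auto simp: abs_mult intro!: mult_left_mono power_mono)
  qed
  let ?P = "qpoch_inf (- norm z) q"
  let ?b = "\<lambda>m. d m * of_real ((inverse q ^ N) ^ m) * qpoch_skip q m z"
  have b: "norm (?b m) \<le> norm (d m) * (q powr (- \<mu>)) ^ m * (?P * norm z powr (- s))" for m
  proof -
    define y where "y = norm z * q ^ m"
    have y: "0 < y" using q z by (simp add: y_def)
    \<comment> \<open>Since \<open>s\<close> lies between 0 and 1, either 1 or \<open>y\<close>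
      dominates the power.\<close>
    have "y powr s \<le> 1 + y"
    proof (cases "y \<le> 1")
      case True
      then have "y powr s \<le> 1" using y s by (simp add: powr_le1)
      with y show ?thesis by simp
    next
      case False
      then have "y powr s \<le> y powr 1" using s by (intro powr_mono) auto
      with y show ?thesis by simp
    qed
    then have "norm (qpoch_skip q m z) * y powr s \<le> norm (qpoch_skip q m z) * (1 + y)"
      by (intro mult_left_mono) auto
    also have "\<dots> \<le> ?P"
      unfolding y_def using q by (intro norm_qpoch_skip_le) auto
    finally have "norm (qpoch_skip q m z) \<le> ?P * y powr (- s)"
      using y by (simp add: powr_minus field_simps)
    also have "y powr (- s) = norm z powr (- s) * (q powr (- s)) ^ m"
      using q z by (simp add: y_def powr_mult powr_realpow[symmetric] powr_powr mult.commute)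
    finally have "norm (?b m) \<le> norm (d m) * (q powr (- real N)) ^ m
        * (?P * (norm z powr (- s) * (q powr (- s)) ^ m))"
      unfolding norm_mult[of _ "qpoch_skip q m z"] norm_a by (intro mult_left_mono) auto
    also have "\<dots> = norm (d m) * (q powr (- \<mu>)) ^ m * (?P * norm z powr (- s))"
      by (simp add: s_def powr_diff powr_minus field_simps power_mult_distrib)
    finally show ?thesis .
  qed
  have "(\<Sum>m. d m * qpoch_skip q m z) = inverse z ^ N * (\<Sum>m. ?b m)"
    using s by (intro suminf_qpoch_skip_shift q z sma moments) auto
  moreover have "norm (\<Sum>m. ?b m) \<le> (\<Sum>m. norm (d m) * (q powr (- \<mu>)) ^ m * (?P * norm z powr (- s)))"
  proof (rule order_trans[OF summable_norm suminf_le])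
    show "summable (\<lambda>m. norm (d m) * (q powr (- \<mu>)) ^ m * (?P * norm z powr (- s)))"
      by (intro summable_mult2 sm)
    from this show "summable (\<lambda>m. norm (?b m))"
      by (rule summable_comparison_test'[where N = 0]) (use b in \<open>simp only: real_norm_def abs_norm_cancel\<close>)
    then show "summable (\<lambda>m. norm (?b m))" .
  qed (fact b)
  ultimately have "norm (\<Sum>m. d m * qpoch_skip q m z)
      \<le> inverse (norm z) ^ N * (\<Sum>m. norm (d m) * (q powr (- \<mu>)) ^ m * (?P * norm z powr (- s)))"
    by (simp add: norm_mult norm_power norm_inverse mult_left_mono)
  also have "\<dots> = (\<Sum>m. norm (d m) * (q powr (- \<mu>)) ^ m)
      * (?P * (inverse (norm z) ^ N * norm z powr (- s)))"
    by (simp add: suminf_mult2[OF sm, symmetric])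
  also have "inverse (norm z) ^ N * norm z powr (- s) = norm z powr (- \<mu>)"
    using z by (simp add: s_def powr_diff powr_minus powr_realpow field_simps)
  finally show ?thesis .
qed


section \<open>The entire extension\<close>

lemma qpoch_pos:
  assumes "0 < q" "q < 1"
  shows "0 < qpoch q q n"
proof -
  have "q ^ Suc j < 1" for j
    using assms by (intro power_Suc_less_one) auto
  then show ?thesis
    unfolding qpoch_def by (intro prod_pos) auto
qed

text \<open>The weight \<open>(q * q ^ j; q)\<close> infinite is
  \<open>qpoch_inf q q / qpoch q q j\<close>, and the power \<open>(q * q ^ j) ^ k\<close> supplies
  both the \<open>q ^ k\<close> cancelled by the prefactor and the argument of
  \<open>rho\<close>.\<close>

lemma A_inf_eq:
  assumes q: "0 < q" "q < 1" and f: "continuous_on {0..1} f"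
  shows "A_inf q k f = of_real (qpoch_inf q q / qpoch q q k) * rho q f (of_real (q ^ k))"
proof -
  let ?t = "\<lambda>j. f (q ^ j) * of_real (q ^ j) / of_real (qpoch q q j) * of_real (q ^ k) ^ j"
  let ?h = "\<lambda>j. of_real (q ^ j) * (f (q ^ j) * of_real (p_inf q k (q * q ^ j)))"
  have split: "qpoch_inf q q = qpoch q q j * qpoch_inf (q * q ^ j) q" for j
    using qpoch_inf_split[of q q j] q by simp
  note pos = qpoch_inf_pos[of q q] qpoch_pos[of q]
  have "bounded (f ` {0..1})"
    by (intro compact_imp_bounded compact_continuous_image f) auto
  then obtain B where B: "\<And>x. x \<in> {0..1} \<Longrightarrow> norm (f x) \<le> B"
    unfolding bounded_iff by blast
  \<comment> \<open>Continuity bounds \<open>f\<close>, and \<open>qpoch q q j\<close> is bounded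
    below by \<open>qpoch_inf q q\<close>, which leaves a geometric majorant.\<close>
  have smt: "summable ?t"
  proof (rule summable_comparison_test'[of "\<lambda>j. B / qpoch_inf q q * q ^ j" 0])
    show "summable (\<lambda>j. B / qpoch_inf q q * q ^ j)"
      using q by (intro summable_mult summable_geometric) auto
    fix j :: nat
    have qj: "q ^ i \<in> {0..1}" for i using q by (auto intro: power_le_one)
    have "qpoch_inf (q * q ^ j) q \<le> 1"
      using q qj[of "Suc j"] by (intro qpoch_inf_le_1) auto
    then have le: "qpoch_inf q q \<le> qpoch q q j"
      unfolding split[of j] using pos(2)[of j] q by simp
    have "norm (?t j) = norm (f (q ^ j)) * q ^ j / qpoch q q j * (q ^ k) ^ j"
      using q pos(2)[of j] by (simp add: norm_mult norm_divide norm_power)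
    also have "\<dots> \<le> B * q ^ j / qpoch_inf q q * 1"
      using q pos(1) pos(2)[of j] le qj B[OF qj] order_trans[OF norm_ge_zero B[OF qj]]
      by (intro mult_mono frac_le mult_nonneg_nonneg) (auto intro!: power_le_one)
    finally show "norm (?t j) \<le> B / qpoch_inf q q * q ^ j" by simp
  qed
  have h: "?h j = of_real (qpoch_inf q q * q ^ k / qpoch q q k) * ?t j" for j
    unfolding split[of j] p_inf_def using q pos(2)[of j] pos(2)[of k]
    by (simp add: field_simps power_mult_distrib power_mult[symmetric])
  have "(\<Sum>j. ?h j) = of_real (qpoch_inf q q * q ^ k / qpoch q q k) * (\<Sum>j. ?t j)"
    unfolding h by (rule suminf_mult[OF smt])
  then show ?thesis
    unfolding A_inf_def q_integral_def rho_def using q by simp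
qed

text \<open>The double series with terms \<open>d m * (x * q ^ m) ^ k\<close> is dominated by the
  product series \<open>norm (d m) * norm x ^ k\<close>, so both orders of summation agree. Summing
  over \<open>k\<close> first gives geometric series.\<close>

lemma suminf_powser_geometric_swap:
  fixes d :: "nat \<Rightarrow> complex" and x :: complex
  assumes q: "0 \<le> q" "q < 1" and d: "summable (\<lambda>m. norm (d m))" and x: "norm x < 1"
  shows "(\<lambda>k. (\<Sum>m. d m * of_real (q ^ k) ^ m) * x ^ k) sums (\<Sum>m. d m / (1 - x * of_real q ^ m))"
proof -
  let ?f = "\<lambda>m k. d m * (x * of_real q ^ m) ^ k"
  have infsum_eq_suminf: "infsum h UNIV = suminf h" if "h summable_on UNIV" for h :: "nat \<Rightarrow> complex"
    using has_sum_imp_sums[OF has_sum_infsum[OF that]] by (simp add: sums_iff)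
  have nf: "norm (?f m k) \<le> norm (d m) * norm x ^ k" for m k
    using q by (auto simp: norm_mult norm_power power_mult_distrib
        intro!: mult_left_mono mult_left_le power_le_one)
  have gx: "(\<lambda>k. norm x ^ k) summable_on UNIV"
    using x by (intro norm_summable_imp_summable_on) simp
  have dx: "(\<lambda>m. norm (d m)) summable_on UNIV"
    using d by (intro norm_summable_imp_summable_on) simp
  have "(\<lambda>p. norm (case p of (m, k) \<Rightarrow> norm (d m) * norm x ^ k)) summable_on UNIV \<times> UNIV"
    unfolding Infinite_Sum.abs_summable_on_Sigma_iff using gx dx
    by (auto simp: norm_mult norm_power infsum_cmult_right' abs_mult infsum_nonneg
             intro!: summable_on_cmult_right summable_on_cmult_left)
  then have ab: "(\<lambda>p. norm (case p of (m, k) \<Rightarrow> ?f m k)) summable_on UNIV \<times> UNIV"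
    by (rule Infinite_Sum.abs_summable_on_comparison_test) (use nf in \<open>auto simp: abs_mult\<close>)
  then have sm: "(\<lambda>(m, k). ?f m k) summable_on UNIV \<times> UNIV"
    by (rule Infinite_Sum.abs_summable_summable)
  have sm': "(\<lambda>(k, m). ?f m k) summable_on UNIV \<times> UNIV"
    using sm by (subst (asm) summable_on_swap) (simp add: case_prod_unfold)
  have inner: "infsum (\<lambda>k. ?f m k) UNIV = d m / (1 - x * of_real q ^ m)" for m
  proof -
    have lt: "norm (x * of_real q ^ m) < 1"
      using x q mult_mono[of "norm x" "norm x" "q ^ m" 1] by (auto simp: norm_mult norm_power power_le_one)
    have "summable (\<lambda>k. norm (?f m k))"
      using lt by (auto simp: norm_mult norm_power intro!: summable_mult summable_geometric)
    then have "infsum (\<lambda>k. ?f m k) UNIV = (\<Sum>k. ?f m k)"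
      by (intro infsum_eq_suminf norm_summable_imp_summable_on)
    also have "\<dots> = d m / (1 - x * of_real q ^ m)"
      using lt by (simp add: suminf_mult suminf_geometric summable_geometric)
    finally show ?thesis .
  qed
  have inner': "infsum (\<lambda>m. ?f m k) UNIV = (\<Sum>m. d m * of_real (q ^ k) ^ m) * x ^ k" for k
  proof -
    have s: "summable (\<lambda>m. norm (d m * of_real (q ^ k) ^ m))"
      by (rule summable_comparison_test'[OF d, of 0])
         (use q in \<open>auto simp: norm_mult norm_power intro!: mult_left_le power_le_one\<close>)
    have eq: "?f m k = d m * of_real (q ^ k) ^ m * x ^ k" for m
      by (simp add: power_mult_distrib power_mult[symmetric] mult_ac)
    have "infsum (\<lambda>m. d m * of_real (q ^ k) ^ m) UNIV = (\<Sum>m. d m * of_real (q ^ k) ^ m)"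
      by (intro infsum_eq_suminf norm_summable_imp_summable_on s)
    then show ?thesis
      unfolding eq by (simp add: infsum_cmult_left')
  qed
  have "(\<lambda>k. infsum (\<lambda>m. ?f m k) UNIV) summable_on UNIV"
    using summable_on_Sigma_banach[OF sm'] by simp
  then have "(\<lambda>k. infsum (\<lambda>m. ?f m k) UNIV) sums infsum (\<lambda>k. infsum (\<lambda>m. ?f m k) UNIV) UNIV"
    by (intro has_sum_imp_sums has_sum_infsum)
  also have "infsum (\<lambda>k. infsum (\<lambda>m. ?f m k) UNIV) UNIV = infsum (\<lambda>m. infsum (\<lambda>k. ?f m k) UNIV) UNIV"
    by (rule infsum_swap_banach[symmetric, OF sm])
  also have "\<dots> = (\<Sum>m. infsum (\<lambda>k. ?f m k) UNIV)"
    using summable_on_Sigma_banach[OF sm] by (intro infsum_eq_suminf) simp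
  finally show ?thesis unfolding inner inner' .
qed

lemma durrmeyer_eq_suminf_qpoch_skip:
  assumes q: "0 < q" "q < 1" and f: "continuous_on {0..1} f" and d: "summable (\<lambda>m. norm (d m))"
    and G: "\<And>u. norm u \<le> 1 \<Longrightarrow>
      (\<Sum>m. d m * u ^ m) = rho q f u * (qpoch_inf (u * of_real q) q)\<^sup>2"
    and x: "x \<in> {0..1}"
  shows "durrmeyer q f x = (\<Sum>m. d m * qpoch_skip q m (of_real x)) / of_real (qpoch_inf q q)"
proof (cases "x = 1")
  case True
  \<comment> \<open>At \<open>x = 1\<close> the factor of index 0 vanishes, so only the term
    \<open>m = 0\<close>, where that factor is removed, survives.\<close>
  have "qpoch (1::complex) q (Suc n) = 0" for n
    unfolding qpoch_def by (intro prod_zero bexI[of _ 0]) auto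
  then have skip: "qpoch_skip q m 1 = (if m = 0 then of_real (qpoch_inf q q) else 0)" for m
    using q qpoch_inf_of_real[of q q, where 'a = complex]
    by (cases m) (simp_all add: qpoch_skip_def)
  have "(\<Sum>m. d m * qpoch_skip q m 1) = d 0 * of_real (qpoch_inf q q)"
    unfolding skip by (subst suminf_finite[of "{0}"]) auto
  \<comment> \<open>At \<open>u = 0\<close> the squared product is 1, so the constant coefficients
    of \<open>G\<close> and \<open>rho\<close> agree. The latter is
    \<open>f (q ^ 0) = f 1\<close>.\<close>
  moreover have "d 0 = rho q f 0"
    using G[of 0] powser_zero[of d] by (simp add: qpoch_inf_def)
  moreover have "rho q f 0 = f 1"
    unfolding rho_def by (subst powser_zero) simp
  ultimately show ?thesis
    using True qpoch_inf_pos[of q q] q by (simp add: durrmeyer_def)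
next
  case False
  then have x: "0 \<le> x" "x < 1" using x by auto
  let ?c = "of_real (qpoch_inf x q / qpoch_inf q q) :: complex"
  \<comment> \<open>Both \<open>A_inf\<close> and \<open>p_inf\<close> contribute a factor
    \<open>1 / qpoch q q k\<close>. Rewriting each as
    \<open>qpoch_inf (q * q ^ k) q / qpoch_inf q q\<close> produces the square in
    \<open>G\<close>.\<close>
  have "A_inf q k f * of_real (p_inf q k x)
      = ?c * ((\<Sum>m. d m * of_real (q ^ k) ^ m) * of_real x ^ k)" for k
  proof -
    have split: "qpoch_inf q q = qpoch q q k * qpoch_inf (q * q ^ k) q"
      using qpoch_inf_split[of q q k] q by simp
    have "(\<Sum>m. d m * of_real (q ^ k) ^ m) = rho q f (of_real (q ^ k)) * (of_real (qpoch_inf (q * q ^ k) q))\<^sup>2"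
      using G[of "of_real (q ^ k)"] qpoch_inf_of_real[of q "q * q ^ k", where 'a = complex] q
      by (simp add: norm_power power_le_one mult.commute)
    moreover have "qpoch_inf (q * q ^ k) q \<noteq> 0" "qpoch q q k \<noteq> 0"
      using split qpoch_inf_pos[of q q] q by auto
    ultimately show ?thesis
      unfolding A_inf_eq[OF q f] p_inf_def split by (simp add: power2_eq_square field_simps)
  qed
  then have "durrmeyer q f x = (\<Sum>k. ?c * ((\<Sum>m. d m * of_real (q ^ k) ^ m) * of_real x ^ k))"
    using x by (simp add: durrmeyer_def)
  also have "\<dots> = ?c * (\<Sum>m. d m / (1 - of_real x * of_real q ^ m))"
    using q x d by (intro sums_unique[symmetric] sums_mult suminf_powser_geometric_swap) auto
  also have "\<dots> = (\<Sum>m. ?c * (d m / (1 - of_real x * of_real q ^ m)))"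
  proof (rule suminf_mult[symmetric])
    \<comment> \<open>All denominators have modulus at least \<open>1 - x\<close>.\<close>
    show "summable (\<lambda>m. d m / (1 - of_real x * of_real q ^ m))"
    proof (rule summable_comparison_test'[of "\<lambda>m. norm (d m) / (1 - x)" 0])
      fix m
      have "norm (1 - of_real x * of_real q ^ m :: complex) = 1 - x * q ^ m"
      proof -
        have "x * q ^ m \<le> 1" using x q by (simp add: mult_le_one power_le_one)
        then have "norm (of_real (1 - x * q ^ m) :: complex) = 1 - x * q ^ m"
          unfolding norm_of_real by simp
        then show ?thesis by simp
      qed
      moreover have "x * q ^ m \<le> x" using x q by (intro mult_left_le power_le_one) auto
      ultimately show "norm (d m / (1 - of_real x * of_real q ^ m)) \<le> norm (d m) / (1 - x)"
        unfolding norm_divide using x by (intro divide_left_mono) auto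
    qed (intro summable_divide d)
  qed
  also have "(\<lambda>m. ?c * (d m / (1 - of_real x * of_real q ^ m)))
      = (\<lambda>m. d m * qpoch_skip q m (of_real x) / of_real (qpoch_inf q q))"
  proof
    fix m
    have "x * q ^ m \<le> x" using x q by (intro mult_left_le power_le_one) auto
    then have "of_real (1 - x * q ^ m) \<noteq> (0::complex)" using x by (simp only: of_real_eq_0_iff)
    then have "1 - of_real x * of_real q ^ m \<noteq> (0::complex)" by simp
    moreover have "S * t / p * (e / t) = e * S / p" if "t \<noteq> 0" for S t p e :: complex
      using that by simp
    moreover have "of_real (qpoch_inf x q) = qpoch_skip q m (of_real x) * (1 - of_real x * of_real q ^ m)"
      using qpoch_skip_mult[of q m "of_real x"] qpoch_inf_of_real[of q x, where 'a = complex] q by simp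
    ultimately show "?c * (d m / (1 - of_real x * of_real q ^ m))
        = d m * qpoch_skip q m (of_real x) / of_real (qpoch_inf q q)"
      unfolding of_real_divide by metis
  qed
  also have "(\<Sum>m. d m * qpoch_skip q m (of_real x) / of_real (qpoch_inf q q))
      = (\<Sum>m. d m * qpoch_skip q m (of_real x)) / of_real (qpoch_inf q q)"
    using q d by (intro suminf_divide summable_qpoch_skip) auto
  finally show ?thesis .
qed

section \<open>Uniqueness of the extension and reduction to the circle\<close>

lemma durrmeyer_entire_eqI:
  assumes F: "F holomorphic_on UNIV" and eq: "\<And>x. x \<in> {0..1} \<Longrightarrow> F (of_real x) = durrmeyer q f x"
  shows "durrmeyer_entire q f = F"
  unfolding durrmeyer_entire_def
proof (rule the_equality)
  \<comment> \<open>Two entire extensions agree on the image of the unit interval, which accumulates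
    at 0, so the identity theorem makes them equal.\<close>
  fix g assume g: "g holomorphic_on UNIV \<and> (\<forall>x\<in>{0..1}. g (of_real x) = durrmeyer q f x)"
  show "g = F"
  proof
    fix w
    have lim: "(0::complex) islimpt of_real ` {0..1}"
      unfolding islimpt_approachable
    proof (intro allI impI)
      fix e :: real assume "0 < e"
      then show "\<exists>x'\<in>of_real ` {0..1}. x' \<noteq> (0::complex) \<and> dist x' 0 < e"
        by (intro bexI[of _ "of_real (min 1 (e / 2))"] imageI) (auto simp: min_def)
    qed
    have hol: "(\<lambda>w. g w - F w) holomorphic_on UNIV"
      using g F by (intro holomorphic_on_diff) auto
    have zero: "g z - F z = 0" if "z \<in> of_real ` {0..1}" for z
      using that g by (auto simp: eq)
    have "g w - F w = 0"
      by (rule analytic_continuation[OF hol _ _ _ _ lim zero]) auto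
    then show "g w = F w" by simp
  qed
qed (use assms in auto)

lemma max_modulus_le:
  assumes h: "h holomorphic_on UNIV" and "0 < r" and B: "\<And>z. norm z = r \<Longrightarrow> norm (h z) \<le> B"
  shows "max_modulus r h \<le> B"
  unfolding max_modulus_def
proof (rule cSUP_least)
  fix z :: complex assume "z \<in> cball 0 r"
  then show "norm (h z) \<le> B"
  proof (rule maximum_modulus_frontier[of h "cball 0 r", rotated 4])
    show "h holomorphic_on interior (cball 0 r)" "continuous_on (closure (cball 0 r)) h"
      using h by (blast intro: holomorphic_on_subset holomorphic_on_imp_continuous_on)+
    show "norm (h w) \<le> B" if "w \<in> frontier (cball 0 r)" for w
      using that \<open>0 < r\<close> by (intro B) simp
  qed simp
qed (use \<open>0 < r\<close> in auto)

section \<open>The growth estimate\<close>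

theorem theorem2p4:
  fixes q R l :: real and f :: "real \<Rightarrow> complex"
  assumes "0 < q" and "q < 1"
    and "continuous_on {0..1} f"
    and "R > 1"
    and "rho q f analytic_on cball 0 R"
    and "l < ln R / ln (1 / q)"
  shows "(\<lambda>r. max_modulus r (durrmeyer_entire q f)) \<in> o[at_top](\<lambda>r. qpoch_inf (- r) q / r powr l)"
proof -
  note q = \<open>0 < q\<close> \<open>q < 1\<close>
  define L where "L = ln R / ln (1 / q)"
  have lnq: "0 < ln (1 / q)" using q by (intro ln_gt_zero) auto
  have L: "0 < L" unfolding L_def using \<open>R > 1\<close> by (intro divide_pos_pos lnq ln_gt_zero)
  \<comment> \<open>The midpoint of \<open>max l 0\<close> and \<open>L\<close> lies strictly above
    \<open>l\<close>, as little-o requires, strictly below \<open>L\<close>, as summability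
    requires, and is nonnegative even when \<open>l\<close> is negative.\<close>
  define \<mu> where "\<mu> = (max l 0 + L) / 2"
  have \<mu>: "l < \<mu>" "0 \<le> \<mu>" "\<mu> < L"
    using L assms(6) by (auto simp: \<mu>_def L_def[symmetric])
  have powr_less_R: "q powr (- a) < R" if "a < L" for a
  proof -
    have "a * ln (1 / q) < ln R"
      using that lnq by (simp add: L_def pos_less_divide_eq)
    then have "exp (a * ln (1 / q)) < exp (ln R)"
      by (rule exp_less_mono)
    then have "exp (a * ln (1 / q)) < R"
      using \<open>R > 1\<close> by simp
    then show ?thesis using q by (simp add: powr_def ln_div)
  qed

  define G where "G = (\<lambda>u. rho q f u * (qpoch_inf (u * of_real q) q)\<^sup>2)"
  have "rho q f holomorphic_on ball 0 R"
    using analytic_imp_holomorphic[OF assms(5)] by (rule holomorphic_on_subset) auto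
  then have hG: "G holomorphic_on ball 0 R"
    unfolding G_def using q by (intro holomorphic_intros) auto
  define d where "d = (\<lambda>n. (deriv ^^ n) G 0 / fact n)"
  have d_sums: "(\<lambda>n. d n * u ^ n) sums G u" if "norm u < R" for u
    using holomorphic_power_series[OF hG, of u] that by (simp add: d_def)
  have smd: "summable (\<lambda>n. norm (d n) * t ^ n)" if t: "0 \<le> t" "t < R" for t
  proof -
    \<comment> \<open>Convergence at the larger radius \<open>t'\<close> gives absolute convergence
      at \<open>t\<close>.\<close>
    obtain t' where t': "t < t'" "t' < R" using dense[OF t(2)] by blast
    have "summable (\<lambda>n. norm (d n * of_real t ^ n))"
      using t t' d_sums[of "of_real t'"]
      by (intro powser_insidea[of _ "of_real t'"]) (auto simp: sums_iff)
    then show ?thesis using t by (simp add: norm_mult norm_power)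
  qed
  have smd1: "summable (\<lambda>n. norm (d n))"
    using smd[of 1] \<open>R > 1\<close> by simp

  define F where "F = (\<lambda>z. (\<Sum>m. d m * qpoch_skip q m z) / of_real (qpoch_inf q q))"
  have pos: "0 < qpoch_inf q q" using q by (intro qpoch_inf_pos) auto
  have hF: "F holomorphic_on UNIV"
    unfolding F_def using q smd1 pos
    by (intro holomorphic_on_divide holomorphic_suminf_qpoch_skip holomorphic_on_const) auto
  have F: "durrmeyer_entire q f = F"
  proof (rule durrmeyer_entire_eqI[OF hF])
    fix x :: real assume "x \<in> {0..1}"
    then show "F (of_real x) = durrmeyer q f x"
      unfolding F_def using q assms(3) smd1 d_sums \<open>R > 1\<close>
      by (subst durrmeyer_eq_suminf_qpoch_skip[of q f d x]) (auto simp: G_def sums_iff)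
  qed

  define C where "C = (\<Sum>m. norm (d m) * (q powr (- \<mu>)) ^ m) / qpoch_inf q q"
  have bound: "max_modulus r F \<le> C * (qpoch_inf (- r) q * r powr (- \<mu>))" if "0 < r" for r
  proof (rule max_modulus_le[OF hF that])
    fix z :: complex assume z: "norm z = r"
    have "norm (\<Sum>m. d m * qpoch_skip q m z)
       \<le> (\<Sum>m. norm (d m) * (q powr (- \<mu>)) ^ m) * (qpoch_inf (- norm z) q * norm z powr (- \<mu>))"
    proof (rule norm_suminf_qpoch_skip_le)
      fix i assume i: "1 \<le> i" "real i \<le> \<mu>"
      have "inverse q ^ i = q powr (- real i)"
        using q by (simp add: powr_minus powr_realpow power_inverse)
      with powr_less_R[of i] i \<mu> have "inverse q ^ i < R" by simp
      \<comment> \<open>Because \<open>i\<close> is at most \<mu> and \<mu> is below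
        \<open>L\<close>, the point \<open>inverse q ^ i\<close> lies in the disc of convergence, so
        the moment is a value of \<open>G\<close>.\<close>
      then have "(\<Sum>m. d m * of_real (inverse q ^ i) ^ m) = G (of_real (inverse q ^ i))"
        using q by (intro sums_unique[symmetric] d_sums) (simp add: norm_power norm_inverse)
      \<comment> \<open>The argument is \<open>inverse q ^ (i - 1)\<close>, so the factor of index
        \<open>i - 1\<close> vanishes; this is where \<open>1 \<le> i\<close> enters.\<close>
      also have "qpoch_inf (of_real (inverse q ^ i) * of_real q) q = (0::complex)"
        using q i by (intro qpoch_inf_eq_0[of _ _ "i - 1"])
          (auto simp: mult.assoc power_Suc[symmetric] power_mult_distrib[symmetric] simp del: power_Suc)
      then have "G (of_real (inverse q ^ i)) = 0" by (simp add: G_def)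
      finally show "(\<Sum>m. d m * of_real ((inverse q ^ i) ^ m)) = 0" by simp
    qed (use q \<mu> z that smd powr_less_R in auto)
    then show "norm (F z) \<le> C * (qpoch_inf (- r) q * r powr (- \<mu>))"
      using pos z by (simp add: F_def C_def norm_divide divide_right_mono)
  qed
  have P: "0 < qpoch_inf (- r) q" if "0 < r" for r :: real
    using that q by (intro qpoch_inf_pos) auto
  have "(\<lambda>r. max_modulus r F) \<in> O(\<lambda>r. qpoch_inf (- r) q * r powr (- \<mu>))"
  proof (rule bigoI[of _ C])
    show "\<forall>\<^sub>F r in at_top. norm (max_modulus r F) \<le> C * norm (qpoch_inf (- r) q * r powr (- \<mu>))"
      using eventually_gt_at_top[of 0]
    proof eventually_elim
      case (elim r)
      have "continuous_on (cball 0 r) F"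
        using hF by (meson holomorphic_on_imp_continuous_on holomorphic_on_subset subset_UNIV)
      \<comment> \<open>Nonnegativity turns the one-sided bound into a bound on the norm.\<close>
      then have "0 \<le> max_modulus r F"
        using max_modulus_attained[of r F] elim by auto
      then show ?case using bound[OF elim] P[OF elim] by (simp add: abs_mult)
    qed
  qed
  \<comment> \<open>The strict inequality \<open>l < \<mu>\<close> upgrades big-O to
    little-o.\<close>
  also have "(\<lambda>r::real. qpoch_inf (- r) q * r powr (- \<mu>)) \<in> o[at_top](\<lambda>r. qpoch_inf (- r) q * r powr (- l))"
    using \<mu> by (intro landau_o.small.mult_left) (simp add: powr_smallo_iff[OF filterlim_ident])
  finally show ?thesis
    unfolding F by (simp add: powr_minus divide_inverse)
qed

end
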